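(* Let $G$ be a group acting on a finite set $X$. Let $\tau\in\mathrm{End}_G(X)$ be an elementary collapsing of type $(H,[K]_{N_H})$, and let $\eta\in\mathrm{End}_G(X)$ be such that $\tau\sim_{\mathcal{R}}\eta$. Then $\eta$ is an elementary collapsing of some type $(H',[K']_{N_{H'}})$, and moreover $H$ and $H'$ are conjugate subgroups of $G$.
   Context: $\mathrm{End}_G(X)$ is the monoid, under composition $(fg)(x)=f(g(x))$, of all $G$-equivariant functions $X\to X$. Write $S=\mathrm{End}_G(X)$. For $a,b\in S$, $a\sim_{\mathcal{R}} b$ means $aS=bS$, where $aS=\{as : s\in S\}$. $G_x$ is the stabilizer and $Gx$ the orbit of $x$. The kernel of $f:X\to X$ is $\ker(f)=\{(x,y)\in X\times X : f(x)=f(y)\}$. For a subgroup $K\le G$ and a subset $N\subseteq G$, $[K]_N=\{n^{-1}Kn : n\in N\}$; $N_H=N_G(H)$ is the normalizer of a subgroup $H\le G$. Definition. For subgroups $H,K\le G$, $\tau\in\mathrm{End}_G(X)$ is an elementary collapsing of type $(H,[K]_{N_H})$ if there exist $x,y\in X$ such that: (i) $Gx\neq Gy$; (ii) $G_x=H$; (iii) $[G_y]_{N_H}=[G_{\tau(x)}]_{N_H}=[K]_{N_H}$; (iv) $\ker(\tau)=\{(a,a): a\in X\}\cup\{(g\cdot x,g\cdot y),(g\cdot y,g\cdot x): g\in G\}\cup\{(g\cdot x,h\cdot x),(h\cdot x,g\cdot x): g,h\in G,\ h^{-1}g\in G_y\}$. *)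

theory Defs
  imports "HOL-Algebra.Group_Action"
begin

text \<open>Maps on the carrier set \<open>X\<close> are taken extensional, as in the library's \<^const>\<open>BijGroup\<close>, so
  that equality of endomorphisms is equality on \<open>X\<close>.\<close>

definition equivariant_End ::
    "('g, 'm) monoid_scheme \<Rightarrow> 'x set \<Rightarrow> ('g \<Rightarrow> 'x \<Rightarrow> 'x) \<Rightarrow> ('x \<Rightarrow> 'x) monoid" where
  "equivariant_End G X \<phi> =
     \<lparr>carrier = {f \<in> X \<rightarrow>\<^sub>E X. \<forall>g\<in>carrier G. \<forall>x\<in>X. f (\<phi> g x) = \<phi> g (f x)},
      mult = compose X,
      one = (\<lambda>x\<in>X. x)\<rparr>"

lemma (in group_action) monoid_equivariant_End: "monoid (equivariant_End G E \<phi>)"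
proof (rule monoidI)
  fix a b assume "a \<in> carrier (equivariant_End G E \<phi>)" "b \<in> carrier (equivariant_End G E \<phi>)"
  then show "a \<otimes>\<^bsub>equivariant_End G E \<phi>\<^esub> b \<in> carrier (equivariant_End G E \<phi>)"
    using element_image by (fastforce simp: equivariant_End_def compose_def PiE_def Pi_def)
next
  show "\<one>\<^bsub>equivariant_End G E \<phi>\<^esub> \<in> carrier (equivariant_End G E \<phi>)"
    using element_image by (auto simp: equivariant_End_def)
next
  fix a b c
  assume "a \<in> carrier (equivariant_End G E \<phi>)" "b \<in> carrier (equivariant_End G E \<phi>)"
    "c \<in> carrier (equivariant_End G E \<phi>)"
  then show "a \<otimes>\<^bsub>equivariant_End G E \<phi>\<^esub> b \<otimes>\<^bsub>equivariant_End G E \<phi>\<^esub> c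
      = a \<otimes>\<^bsub>equivariant_End G E \<phi>\<^esub> (b \<otimes>\<^bsub>equivariant_End G E \<phi>\<^esub> c)"
    by (auto simp: equivariant_End_def PiE_def compose_assoc)
qed (auto simp: equivariant_End_def PiE_def)

definition green_R :: "('a, 'm) monoid_scheme \<Rightarrow> 'a \<Rightarrow> 'a \<Rightarrow> bool" where
  "green_R S a b \<longleftrightarrow> a <#\<^bsub>S\<^esub> carrier S = b <#\<^bsub>S\<^esub> carrier S"

definition map_kernel :: "'x set \<Rightarrow> ('x \<Rightarrow> 'y) \<Rightarrow> ('x \<times> 'x) set" where
  "map_kernel X f = {(x, y) \<in> X \<times> X. f x = f y}"

definition conj_class_by :: "('g, 'm) monoid_scheme \<Rightarrow> 'g set \<Rightarrow> 'g set \<Rightarrow> 'g set set" where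
  "conj_class_by G N K = {inv\<^bsub>G\<^esub> n <#\<^bsub>G\<^esub> K #>\<^bsub>G\<^esub> n | n. n \<in> N}"

definition conjugate_subgroups :: "('g, 'm) monoid_scheme \<Rightarrow> 'g set \<Rightarrow> 'g set \<Rightarrow> bool" where
  "conjugate_subgroups G H H' \<longleftrightarrow>
     subgroup H G \<and> subgroup H' G \<and> (\<exists>g\<in>carrier G. H' = inv\<^bsub>G\<^esub> g <#\<^bsub>G\<^esub> H #>\<^bsub>G\<^esub> g)"

text \<open>\<open>elementary_collapsing G X \<phi> H K \<tau>\<close>: the map \<open>\<tau>\<close> is an elementary collapsing of type
  \<open>(H, [K]\<^sub>N)\<close> with \<open>N\<close> the normalizer of \<open>H\<close>. The type is given through the representative \<open>K\<close>;
  only the class of \<open>K\<close> matters among subgroups.\<close>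

definition elementary_collapsing ::
    "('g, 'm) monoid_scheme \<Rightarrow> 'x set \<Rightarrow> ('g \<Rightarrow> 'x \<Rightarrow> 'x) \<Rightarrow> 'g set \<Rightarrow> 'g set \<Rightarrow> ('x \<Rightarrow> 'x) \<Rightarrow> bool"
where
  "elementary_collapsing G X \<phi> H K \<tau> \<longleftrightarrow>
     subgroup H G \<and> subgroup K G \<and> \<tau> \<in> carrier (equivariant_End G X \<phi>) \<and>
     (\<exists>x\<in>X. \<exists>y\<in>X.
        orbit G \<phi> x \<noteq> orbit G \<phi> y \<and>
        stabilizer G \<phi> x = H \<and>
        conj_class_by G (normalizer G H) (stabilizer G \<phi> y)
          = conj_class_by G (normalizer G H) (stabilizer G \<phi> (\<tau> x)) \<and>
        conj_class_by G (normalizer G H) (stabilizer G \<phi> (\<tau> x))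
          = conj_class_by G (normalizer G H) K \<and>
        map_kernel X \<tau> =
          {(a, a) | a. a \<in> X}
          \<union> ({(\<phi> g x, \<phi> g y) | g. g \<in> carrier G} \<union> {(\<phi> g y, \<phi> g x) | g. g \<in> carrier G})
          \<union> ({(\<phi> g x, \<phi> h x) | g h. g \<in> carrier G \<and> h \<in> carrier G \<and>
                 inv\<^bsub>G\<^esub> h \<otimes>\<^bsub>G\<^esub> g \<in> stabilizer G \<phi> y}
            \<union> {(\<phi> h x, \<phi> g x) | g h. g \<in> carrier G \<and> h \<in> carrier G \<and>
                 inv\<^bsub>G\<^esub> h \<otimes>\<^bsub>G\<^esub> g \<in> stabilizer G \<phi> y}))"

end

theory Submission
  imports Defs
begin

text \<open>An elementary collapsing is an endomorphism that is injective outside the orbit of some point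
  \<open>x\<close> and maps \<open>x\<close> into the image of the other orbits. If \<open>\<tau>\<close> has this form and
  \<open>\<tau> = \<eta> s\<close>, \<open>\<eta> = \<tau> t\<close>, then \<open>s\<close> is injective and preserves stabilizers outside
  the orbit \<open>Gx\<close>. Let \<open>Y\<close> be the image of \<open>X - Gx\<close> under \<open>s\<close>. Counting the points with stabilizer
  \<open>G\<^sub>x\<close> yields such a point \<open>x'\<close> outside \<open>Y\<close>, and counting all points gives \<open>X - Y = Gx'\<close>.
  Now \<open>\<eta>\<close> is injective on \<open>Y\<close>, and it maps \<open>Y\<close> onto the image of \<open>\<tau>\<close>, which is that of \<open>\<eta>\<close>.\<close>

context group_action
begin

lemma orbit_subset: "x \<in> E \<Longrightarrow> orbit G \<phi> x \<subseteq> E"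
  using element_image by (auto simp: orbit_def)

lemma action_inv_cancel:
  assumes "g \<in> carrier G" "x \<in> E"
  shows "\<phi> (inv g) (\<phi> g x) = x"
  using orbit_sym_aux[OF assms] by simp

lemma action_cancel_inv:
  assumes "g \<in> carrier G" "x \<in> E"
  shows "\<phi> g (\<phi> (inv g) x) = x"
proof -
  interpret group G using group_hom group_hom.axioms(1) by auto
  show ?thesis using action_inv_cancel[of "inv g" x] assms by simp
qed

text \<open>Translates the coset condition in the third part of the kernel of a collapsing into an
  equality of points.\<close>

lemma inv_mult_in_stabilizer_iff:
  assumes "g \<in> carrier G" "h \<in> carrier G" "x \<in> E"
  shows "inv h \<otimes> g \<in> stabilizer G \<phi> x \<longleftrightarrow> \<phi> g x = \<phi> h x"
proof -
  interpret group G using group_hom group_hom.axioms(1) by auto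
  have "\<phi> (inv h \<otimes> g) x = \<phi> (inv h) (\<phi> g x)"
    using assms by (simp add: composition_rule)
  moreover have "\<phi> (inv h) (\<phi> g x) = x \<longleftrightarrow> \<phi> g x = \<phi> h x"
    using assms action_inv_cancel[of h x] action_cancel_inv[of h "\<phi> g x"]
      element_image[OF assms(1,3) refl] by metis
  ultimately show ?thesis
    using assms(1,2) by (simp add: stabilizer_def)
qed

lemma action_mem_orbit_iff:
  assumes "g \<in> carrier G" "x \<in> E" "z \<in> E"
  shows "\<phi> g z \<in> orbit G \<phi> x \<longleftrightarrow> z \<in> orbit G \<phi> x"
proof -
  have "\<phi> g z \<in> orbit G \<phi> z" "\<phi> g z \<in> E"
    using assms element_image by (auto simp: orbit_def)
  then show ?thesis
    using assms orbit_trans orbit_sym by blast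
qed

text \<open>By orbit-stabilizer, both orbits are in bijection with the cosets of the common
  stabilizer.\<close>

lemma card_orbit_cong:
  assumes "x \<in> E" "y \<in> E" "stabilizer G \<phi> x = stabilizer G \<phi> y"
  shows "card (orbit G \<phi> x) = card (orbit G \<phi> y)"
  using bij_betw_same_card[OF orbit_stab_fun_is_bij[OF assms(1)]]
    bij_betw_same_card[OF orbit_stab_fun_is_bij[OF assms(2)]] assms(3) by simp

lemma equivariant_End_closed:
  "f \<in> carrier (equivariant_End G E \<phi>) \<Longrightarrow> x \<in> E \<Longrightarrow> f x \<in> E"
  by (auto simp: equivariant_End_def)

lemma equivariant_End_commute:
  "f \<in> carrier (equivariant_End G E \<phi>) \<Longrightarrow> g \<in> carrier G \<Longrightarrow> x \<in> E \<Longrightarrow> f (\<phi> g x) = \<phi> g (f x)"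
  by (auto simp: equivariant_End_def)

text \<open>By equivariance, \<open>g\<close> fixes \<open>f z\<close> iff
  \<open>f (\<phi> g z) = f z\<close>; both arguments lie in the invariant set \<open>A\<close>, so
  injectivity there cancels \<open>f\<close>.\<close>

lemma stabilizer_equivariant_inj_on:
  assumes f: "f \<in> carrier (equivariant_End G E \<phi>)" and inj: "inj_on f A"
    and A: "A \<subseteq> E" "\<And>g z. g \<in> carrier G \<Longrightarrow> z \<in> A \<Longrightarrow> \<phi> g z \<in> A"
    and "z \<in> A"
  shows "stabilizer G \<phi> (f z) = stabilizer G \<phi> z"
proof -
  have "\<phi> g (f z) = f z \<longleftrightarrow> \<phi> g z = z" if "g \<in> carrier G" for g
    using equivariant_End_commute[OF f that, of z] inj_onD[OF inj, of "\<phi> g z" z] A \<open>z \<in> A\<close> that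
    by auto
  then show ?thesis by (auto simp: stabilizer_def)
qed

text \<open>Every off-diagonal pair of the prescribed kernel has an entry in the orbit of
  \<open>x\<close>, whence the injectivity. The point \<open>y\<close> of the definition lies
  outside that orbit and has the same image as \<open>x\<close>.\<close>

lemma elementary_collapsingE:
  assumes "elementary_collapsing G E \<phi> H K \<tau>"
  obtains x where "x \<in> E" "stabilizer G \<phi> x = H" "inj_on \<tau> (E - orbit G \<phi> x)"
    "\<tau> x \<in> \<tau> ` (E - orbit G \<phi> x)"
proof -
  interpret group G using group_hom group_hom.axioms(1) by auto
  obtain x y where xy: "x \<in> E" "y \<in> E" "orbit G \<phi> x \<noteq> orbit G \<phi> y" "stabilizer G \<phi> x = H"
    and ker: "map_kernel E \<tau> =
          {(a, a) | a. a \<in> E}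
          \<union> ({(\<phi> g x, \<phi> g y) | g. g \<in> carrier G} \<union> {(\<phi> g y, \<phi> g x) | g. g \<in> carrier G})
          \<union> ({(\<phi> g x, \<phi> h x) | g h. g \<in> carrier G \<and> h \<in> carrier G \<and>
                 inv h \<otimes> g \<in> stabilizer G \<phi> y}
            \<union> {(\<phi> h x, \<phi> g x) | g h. g \<in> carrier G \<and> h \<in> carrier G \<and>
                 inv h \<otimes> g \<in> stabilizer G \<phi> y})"
    using assms unfolding elementary_collapsing_def by (elim conjE bexE) (rule that)
  have "y \<notin> orbit G \<phi> x"
    using xy disjoint_union[of "orbit G \<phi> x" "orbit G \<phi> y"] orbit_refl[of y]
    by (auto simp: orbits_def)
  \<comment> \<open>The identity, taken as \<open>g\<close> in the second part of the kernel, yields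
    the pair \<open>(x, y)\<close>.\<close>
  moreover have "\<phi> \<one> x = x" "\<phi> \<one> y = y"
    using xy id_eq_one by (metis restrict_apply')+
  then have "\<exists>g. (x, y) = (\<phi> g x, \<phi> g y) \<and> g \<in> carrier G"
    by (intro exI[of _ \<one>]) simp
  then have "(x, y) \<in> map_kernel E \<tau>"
    unfolding ker Un_iff mem_Collect_eq by (intro disjI1 disjI2)
  then have "\<tau> x = \<tau> y" by (simp add: map_kernel_def)
  moreover have "inj_on \<tau> (E - orbit G \<phi> x)"
  proof (rule inj_onI)
    fix a b assume ab: "a \<in> E - orbit G \<phi> x" "b \<in> E - orbit G \<phi> x" "\<tau> a = \<tau> b"
    then have "(a, b) \<in> map_kernel E \<tau>" by (simp add: map_kernel_def)
    then show "a = b" using ab unfolding ker by (auto simp: orbit_def)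
  qed
  ultimately show thesis using that xy by blast
qed

text \<open>A converse to \<open>elementary_collapsingE\<close>. Each \<open>\<phi> g x\<close> has
  the same image as \<open>\<phi> g y\<close>, so the whole kernel is determined by injectivity off
  the orbit of \<open>x\<close>. The conjugacy classes agree because the stabilizers of
  \<open>y\<close> and \<open>\<eta> x\<close> are equal.\<close>

lemma elementary_collapsingI:
  assumes \<eta>: "\<eta> \<in> carrier (equivariant_End G E \<phi>)" and x: "x \<in> E"
    and inj: "inj_on \<eta> (E - orbit G \<phi> x)"
    and y: "y \<in> E - orbit G \<phi> x" "\<eta> x = \<eta> y"
  shows "elementary_collapsing G E \<phi> (stabilizer G \<phi> x) (stabilizer G \<phi> y) \<eta>"
proof -
  interpret group G using group_hom group_hom.axioms(1) by auto
  let ?B = "E - orbit G \<phi> x"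
  note comm = equivariant_End_commute[OF \<eta>]
  have yE: "y \<in> E" using y by simp
  have B: "\<phi> g z \<in> ?B" if "g \<in> carrier G" "z \<in> ?B" for g z
    using that x element_image by (auto simp: action_mem_orbit_iff)
  have stab: "stabilizer G \<phi> (\<eta> x) = stabilizer G \<phi> y"
    using stabilizer_equivariant_inj_on[OF \<eta> inj _ B y(1)] y(2) by auto
  have orb: "orbit G \<phi> x \<noteq> orbit G \<phi> y"
    using y orbit_refl by auto
  have gx: "\<eta> (\<phi> g x) = \<eta> (\<phi> g y)" if "g \<in> carrier G" for g
    using that x yE y by (simp add: comm)
  have gy: "\<eta> (\<phi> g y) = \<eta> (\<phi> h y) \<longleftrightarrow> \<phi> g y = \<phi> h y"
    if "g \<in> carrier G" "h \<in> carrier G" for g h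
    using inj_on_eq_iff[OF inj B[OF _ y(1)] B[OF _ y(1)]] that by blast
  have mem: "\<phi> g x \<in> E" "\<phi> g y \<in> E" if "g \<in> carrier G" for g
    using that x yE element_image by auto
  have ker: "map_kernel E \<eta> =
          {(a, a) | a. a \<in> E}
          \<union> ({(\<phi> g x, \<phi> g y) | g. g \<in> carrier G} \<union> {(\<phi> g y, \<phi> g x) | g. g \<in> carrier G})
          \<union> ({(\<phi> g x, \<phi> h x) | g h. g \<in> carrier G \<and> h \<in> carrier G \<and>
                 inv h \<otimes> g \<in> stabilizer G \<phi> y}
            \<union> {(\<phi> h x, \<phi> g x) | g h. g \<in> carrier G \<and> h \<in> carrier G \<and>
                 inv h \<otimes> g \<in> stabilizer G \<phi> y})" (is "_ = ?R")
  proof (intro subset_antisym subrelI)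
    fix a b assume "(a, b) \<in> map_kernel E \<eta>"
    then have ab: "a \<in> E" "b \<in> E" "\<eta> a = \<eta> b" by (auto simp: map_kernel_def)
    consider (in_in) "a \<in> orbit G \<phi> x" "b \<in> orbit G \<phi> x" | (in_out) "a \<in> orbit G \<phi> x" "b \<in> ?B"
      | (out_in) "a \<in> ?B" "b \<in> orbit G \<phi> x" | (out_out) "a \<in> ?B" "b \<in> ?B"
      using ab by blast
    then show "(a, b) \<in> ?R"
    proof cases
      case in_in
      then obtain g h where gh: "g \<in> carrier G" "h \<in> carrier G" "a = \<phi> g x" "b = \<phi> h x"
        by (auto simp: orbit_def)
      \<comment> \<open>Replacing \<open>x\<close> by \<open>y\<close> gives
        \<open>\<eta> (\<phi> g y) = \<eta> (\<phi> h y)\<close>, and \<open>\<eta>\<close> is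
        injective at these points.\<close>
      then have "inv h \<otimes> g \<in> stabilizer G \<phi> y"
        using ab gx gy yE by (simp add: inv_mult_in_stabilizer_iff)
      then show ?thesis using gh by blast
    next
      case in_out
      then obtain g where g: "g \<in> carrier G" "a = \<phi> g x" by (auto simp: orbit_def)
      then have "b = \<phi> g y"
        using ab gx in_out B[OF _ y(1)] inj_onD[OF inj] by metis
      then show ?thesis using g by blast
    next
      case out_in
      then obtain g where g: "g \<in> carrier G" "b = \<phi> g x" by (auto simp: orbit_def)
      then have "a = \<phi> g y"
        using ab gx out_in B[OF _ y(1)] inj_onD[OF inj] by metis
      then show ?thesis using g by blast
    next
      case out_out
      then show ?thesis using ab inj_onD[OF inj] by blast
    qed
  next
    fix a b assume "(a, b) \<in> ?R"
    then show "(a, b) \<in> map_kernel E \<eta>"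
      using gx gy mem yE by (auto simp: map_kernel_def inv_mult_in_stabilizer_iff)
  qed
  show ?thesis
    unfolding elementary_collapsing_def
    by (intro conjI bexI[OF _ x] bexI[OF _ yE] stabilizer_subgroup x yE \<eta> orb ker refl)
      (simp_all only: stab)
qed

text \<open>Counting only the points with the stabilizer of \<open>x\<close>, rather than all
  points, ensures that the missing orbit has a point with exactly this stabilizer.\<close>

lemma complement_of_embedded_orbit_complement:
  assumes fin: "finite E" and x: "x \<in> E"
    and inj: "inj_on s (E - orbit G \<phi> x)"
    and Y: "s ` (E - orbit G \<phi> x) = Y" "Y \<subseteq> E"
    and inv: "\<And>g z. g \<in> carrier G \<Longrightarrow> z \<in> Y \<Longrightarrow> \<phi> g z \<in> Y"
    and stab: "\<And>z. z \<in> E - orbit G \<phi> x \<Longrightarrow> stabilizer G \<phi> (s z) = stabilizer G \<phi> z"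
  obtains x' where "x' \<in> E" "stabilizer G \<phi> x' = stabilizer G \<phi> x" "E - Y = orbit G \<phi> x'"
proof -
  interpret group G using group_hom group_hom.axioms(1) by auto
  let ?O = "orbit G \<phi> x"
  let ?P = "\<lambda>z. stabilizer G \<phi> z = stabilizer G \<phi> x"
  have "bij_betw s {z \<in> E - ?O. ?P z} {z \<in> Y. ?P z}"
    using inj stab Y(1) by (force simp: bij_betw_def inj_on_def)
  then have "card {z \<in> Y. ?P z} = card {z \<in> E - ?O. ?P z}"
    by (simp add: bij_betw_same_card)
  \<comment> \<open>Strict because \<open>x\<close> itself is counted on the right only.\<close>
  also have "\<dots> < card {z \<in> E. ?P z}"
    using fin x orbit_refl[OF x] by (intro psubset_card_mono) auto
  finally have "{z \<in> Y. ?P z} \<noteq> {z \<in> E. ?P z}" by auto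
  then obtain x' where x': "x' \<in> E" "x' \<notin> Y" "?P x'" using Y(2) by blast
  \<comment> \<open>If the orbit met \<open>Y\<close>, invariance under the inverse element would
    put \<open>x'\<close> into \<open>Y\<close>.\<close>
  have "orbit G \<phi> x' \<subseteq> E - Y"
  proof
    fix z assume "z \<in> orbit G \<phi> x'"
    then obtain g where g: "g \<in> carrier G" "z = \<phi> g x'" by (auto simp: orbit_def)
    then show "z \<in> E - Y"
      using x' element_image inv[of "inv g" z] action_inv_cancel[of g x'] by auto
  qed
  moreover have "card (E - Y) = card (orbit G \<phi> x')"
  proof -
    have "card Y = card (E - ?O)"
      using card_image[OF inj] Y(1) by simp
    also have "\<dots> = card E - card ?O"
      using fin orbit_subset[OF x] by (simp add: card_Diff_subset finite_subset)
    finally have "card (E - Y) = card E - (card E - card ?O)"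
      using fin Y(2) by (simp add: card_Diff_subset finite_subset)
    \<comment> \<open>Truncated subtraction is harmless here, since the orbit has at most
      \<open>card E\<close> points.\<close>
    also have "\<dots> = card ?O"
      using card_mono[OF fin orbit_subset[OF x]] by simp
    finally show ?thesis using card_orbit_cong[OF x'(1) x x'(3)] by simp
  qed
  ultimately have "E - Y = orbit G \<phi> x'"
    using fin by (metis card_subset_eq finite_Diff)
  then show thesis using that x' by blast
qed

text \<open>The identity of the monoid puts \<open>a\<close> into its own right ideal, which is also
  that of \<open>b\<close>.\<close>

lemma green_R_factor:
  assumes "green_R (equivariant_End G E \<phi>) a b" "a \<in> carrier (equivariant_End G E \<phi>)"
  obtains s where "s \<in> carrier (equivariant_End G E \<phi>)" "\<And>z. z \<in> E \<Longrightarrow> a z = b (s z)"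
proof -
  interpret S: monoid "equivariant_End G E \<phi>" by (rule monoid_equivariant_End)
  have "a \<in> a <#\<^bsub>equivariant_End G E \<phi>\<^esub> carrier (equivariant_End G E \<phi>)"
    using S.one_closed S.r_one[OF assms(2)] by (force simp: l_coset_def)
  then obtain s where "s \<in> carrier (equivariant_End G E \<phi>)" "a = b \<otimes>\<^bsub>equivariant_End G E \<phi>\<^esub> s"
    using assms(1) by (auto simp: green_R_def l_coset_def)
  then show thesis
    using that by (auto simp: equivariant_End_def compose_def)
qed

text \<open>The subgroup \<open>H\<close> is kept exactly, not only up to conjugacy.\<close>

lemma elementary_collapsing_green_R:
  assumes fin: "finite E" and \<tau>: "\<tau> \<in> carrier (equivariant_End G E \<phi>)"
    and \<eta>: "\<eta> \<in> carrier (equivariant_End G E \<phi>)"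
    and coll: "elementary_collapsing G E \<phi> H K \<tau>"
    and R: "green_R (equivariant_End G E \<phi>) \<tau> \<eta>"
  shows "\<exists>K'. elementary_collapsing G E \<phi> H K' \<eta>"
proof -
  obtain x where x: "x \<in> E" "stabilizer G \<phi> x = H" and inj: "inj_on \<tau> (E - orbit G \<phi> x)"
    and "\<tau> x \<in> \<tau> ` (E - orbit G \<phi> x)"
    using elementary_collapsingE[OF coll] .
  let ?A = "E - orbit G \<phi> x"
  obtain w where w: "w \<in> ?A" "\<tau> x = \<tau> w" using \<open>\<tau> x \<in> \<tau> ` ?A\<close> by blast
  obtain s where s: "s \<in> carrier (equivariant_End G E \<phi>)" "\<And>z. z \<in> E \<Longrightarrow> \<tau> z = \<eta> (s z)"
    using green_R_factor[OF R \<tau>] by blast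
  obtain t where t: "t \<in> carrier (equivariant_End G E \<phi>)" "\<And>z. z \<in> E \<Longrightarrow> \<eta> z = \<tau> (t z)"
    using green_R_factor[OF _ \<eta>] R by (metis green_R_def)
  have A: "\<phi> g z \<in> ?A" if "g \<in> carrier G" "z \<in> ?A" for g z
    using that x element_image by (auto simp: action_mem_orbit_iff)
  \<comment> \<open>The collapsed orbit adds nothing to the image: \<open>\<phi> g x\<close> and
    \<open>\<phi> g w\<close> have the same value, and \<open>\<phi> g w\<close> stays in
    \<open>?A\<close>.\<close>
  have img: "\<tau> z \<in> \<tau> ` ?A" if "z \<in> E" for z
  proof (cases "z \<in> orbit G \<phi> x")
    case True
    then obtain g where g: "g \<in> carrier G" "z = \<phi> g x" by (auto simp: orbit_def)
    then have "\<tau> z = \<tau> (\<phi> g w)"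
      using equivariant_End_commute[OF \<tau>] x w by simp
    then show ?thesis using A[OF g(1) w(1)] by blast
  qed (use that in blast)
  \<comment> \<open>Injectivity of the composite \<open>\<eta> s\<close> on \<open>?A\<close> passes
    to \<open>s\<close> on \<open>?A\<close> and to \<open>\<eta>\<close> on the image.\<close>
  have injs: "inj_on s ?A"
    using inj s(2) by (auto simp: inj_on_def)
  have inj\<eta>: "inj_on \<eta> (s ` ?A)"
    using inj s(2) by (auto simp: inj_on_def)
  have sub: "s ` ?A \<subseteq> E" using equivariant_End_closed[OF s(1)] by blast
  have inv: "\<phi> g z \<in> s ` ?A" if "g \<in> carrier G" "z \<in> s ` ?A" for g z
  proof -
    obtain v where "v \<in> ?A" "z = s v" using \<open>z \<in> s ` ?A\<close> by blast
    then show ?thesis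
      using A[OF that(1)] equivariant_End_commute[OF s(1) that(1), of v] by (metis DiffD1 imageI)
  qed
  have "stabilizer G \<phi> (s z) = stabilizer G \<phi> z" if "z \<in> ?A" for z
    using stabilizer_equivariant_inj_on[OF s(1) injs _ A that] by blast
  then obtain x' where x': "x' \<in> E" "stabilizer G \<phi> x' = stabilizer G \<phi> x"
      "E - s ` ?A = orbit G \<phi> x'"
    using complement_of_embedded_orbit_complement[OF fin x(1) injs refl sub inv] by blast
  then have Y: "E - orbit G \<phi> x' = s ` ?A" using sub by blast
  \<comment> \<open>Here \<open>\<eta> = \<tau> t\<close> is used. Writing the value as
    \<open>\<tau> v = \<eta> (s v)\<close> then gives \<open>s v\<close> as the point outside the
    orbit of \<open>x'\<close> with which \<open>x'\<close> is identified.\<close>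
  have "\<eta> x' \<in> \<tau> ` ?A"
    using t(2)[OF x'(1)] img equivariant_End_closed[OF t(1) x'(1)] by simp
  then obtain v where "v \<in> ?A" "\<eta> x' = \<eta> (s v)" using s(2) by auto
  then show ?thesis
    using elementary_collapsingI[OF \<eta> x'(1), of "s v"] inj\<eta> x x'(2) unfolding Y by auto
qed

end

lemma (in group) conjugate_subgroups_refl:
  assumes "subgroup H G"
  shows "conjugate_subgroups G H H"
  using assms subgroup.subset[OF assms] lcos_mult_one coset_mult_one
  by (force simp: conjugate_subgroups_def intro!: bexI[of _ \<one>])

theorem corollary34:
  fixes G :: "('g, 'm) monoid_scheme"
    and X :: "'x set"
    and \<phi> :: "'g \<Rightarrow> 'x \<Rightarrow> 'x"
    and H K :: "'g set"
    and \<tau> \<eta> :: "'x \<Rightarrow> 'x"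
  assumes "group_action G X \<phi>"
    and "finite X"
    and "\<tau> \<in> carrier (equivariant_End G X \<phi>)"
    and "elementary_collapsing G X \<phi> H K \<tau>"
    and "\<eta> \<in> carrier (equivariant_End G X \<phi>)"
    and "green_R (equivariant_End G X \<phi>) \<tau> \<eta>"
  shows "\<exists>H' K'. elementary_collapsing G X \<phi> H' K' \<eta> \<and> conjugate_subgroups G H H'"
proof -
  interpret group_action G X \<phi> by fact
  interpret group G using group_hom group_hom.axioms(1) by auto
  have "subgroup H G" using assms(4) by (simp add: elementary_collapsing_def)
  \<comment> \<open>The witness for \<open>H'\<close> is \<open>H\<close>, conjugate to itself by
    the identity.\<close>
  then show ?thesis
    using elementary_collapsing_green_R[OF assms(2,3,5,4,6)] conjugate_subgroups_refl by blast
qed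

end
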